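(* Let $n\geq 6$, let $\mathbf c$ be a maximal composition of $n$, and set $\ell=\lfloor n/3\rfloor$. Then \begin{itemize} \item if $n\equiv0\pmod{3}$, $\mathrm{P}(\mathbf{c})=\tfrac{1}{5}3^{2-\ell}\,n!$; \item if $n\equiv1\pmod{3}$, $\mathrm{P}(\mathbf{c})=\tfrac{2}{5} 3^{1-\ell}\,n!$; \item if $n\equiv2\pmod{3}$, $\mathrm{P}(\mathbf{c})=3^{-\ell}\,n!$. \end{itemize}
   Context: For $n\geq1$, $\mathcal S_n$ is the symmetric group of $[n]=\{1,\dots,n\}$; permutations are written as words $\sigma=\sigma_1\cdots\sigma_n$. An index $i$ is a peak of $\sigma$ if $\sigma_{i-1}<\sigma_i>\sigma_{i+1}$. A composition of $n$ is a finite sequence of positive integers with sum $n$. If the peak set of $\sigma\in\mathcal S_n$ is $\{i_1<\dots<i_k\}$, the peak-composition of $\sigma$ is $(c_1,\dots,c_{k+1})$ with $c_j=i_j-i_{j-1}$, where $i_0=0$, $i_{k+1}=n$. For a composition $\mathbf c$ of $n$, $\mathrm{P}(\mathbf c)$ is the number of $\sigma\in\mathcal S_n$ with peak-composition $\mathbf c$. A composition $\mathbf c$ of $n$ is maximal if $\mathrm{P}(\mathbf b)\le \mathrm{P}(\mathbf c)$ for every composition $\mathbf b$ of $n$. *)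

theory Defs
  imports Complex_Main "HOL-Combinatorics.Permutations"
begin

text \<open>
  The word \<open>\<sigma>\<^sub>1 \<dots> \<sigma>\<^sub>n\<close> is represented by a function \<open>\<sigma>\<close> that permutes \<open>{1..n}\<close>, with
  \<open>\<sigma>\<^sub>i = \<sigma> i\<close>. A peak must have both neighbours in \<open>{1..n}\<close>, so \<open>1\<close> and \<open>n\<close> are never peaks.
\<close>

definition peak_set :: "nat \<Rightarrow> (nat \<Rightarrow> nat) \<Rightarrow> nat set" where
  "peak_set n \<sigma> = {i \<in> {1<..<n}. \<sigma> (i - 1) < \<sigma> i \<and> \<sigma> i > \<sigma> (i + 1)}"

text \<open>The list \<open>xs\<close> below is \<open>[i\<^sub>0, i\<^sub>1, \<dots>, i\<^sub>k\<^sub>+\<^sub>1]\<close> with \<open>i\<^sub>0 = 0\<close> and \<open>i\<^sub>k\<^sub>+\<^sub>1 = n\<close>. It is increasing, so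
  the subtraction on natural numbers never truncates.\<close>

definition peak_composition :: "nat \<Rightarrow> (nat \<Rightarrow> nat) \<Rightarrow> nat list" where
  "peak_composition n \<sigma> =
     (let xs = [0] @ sorted_list_of_set (peak_set n \<sigma>) @ [n]
      in map (\<lambda>j. xs ! j - xs ! (j - 1)) [1..<length xs])"

definition is_composition :: "nat \<Rightarrow> nat list \<Rightarrow> bool" where
  "is_composition n c \<longleftrightarrow> (\<forall>x \<in> set c. x > 0) \<and> sum_list c = n"

definition peak_count :: "nat \<Rightarrow> nat list \<Rightarrow> nat" where
  "peak_count n c = card {\<sigma>. \<sigma> permutes {1..n} \<and> peak_composition n \<sigma> = c}"

definition maximal_composition :: "nat \<Rightarrow> nat list \<Rightarrow> bool" where
  "maximal_composition n c \<longleftrightarrow>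
     is_composition n c \<and> (\<forall>b. is_composition n b \<longrightarrow> peak_count n b \<le> peak_count n c)"

end

theory Submission
  imports Defs "HOL-Computational_Algebra.Polynomial"
begin

text \<open>
  Write \<open>p(c) = P(c) / n!\<close>, the probability that independent uniform entries have peak-composition \<open>c\<close>.
  It is computed by integrating over the entries from left to right, so that all densities are
  polynomials on \<open>[0, 1]\<close>. Let \<open>M(n)\<close> be the claimed maximum of \<open>p\<close>. A monotonicity argument
  gives \<open>p(u, g, v) \<le> p(u, 2) p(g, v)\<close> for \<open>g \<ge> 3\<close>, with equality if \<open>g = 3\<close> and \<open>v\<close> is nonempty. As
  \<open>M(a) M(b) \<le> M(a + b - 2)\<close>, induction on \<open>n\<close> disposes of every composition with an inner part \<open>\<ge> 3\<close>,
  and similarly of those with a first part \<open>\<ge> 5\<close> or a last part \<open>\<ge> 4\<close>. In the remaining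
  compositions all inner parts are \<open>2\<close>, and \<open>p\<close> is bounded by the probabilities that words of odd length
  alternate, for which crude estimates suffice. By the equality case, \<open>M(n)\<close> is attained at
  \<open>(3, \<dots>, 3, 3)\<close>, \<open>(3, \<dots>, 3, 2, 2)\<close> and \<open>(3, \<dots>, 3, 2)\<close>.
\<close>

section \<open>Densities of peak-compositions\<close>

definition anti :: "real poly \<Rightarrow> real poly" where
  "anti p = (\<Sum>i\<le>degree p. monom (coeff p i / real (Suc i)) (Suc i))"

definition mass :: "real poly \<Rightarrow> real" where
  "mass p = poly (anti p) 1"

text \<open>The integral of \<open>p\<close> over \<open>[x, 1]\<close>: the density at
  \<open>x\<close> of an entry below its predecessor, just as \<open>anti p\<close> is that of an
  entry above it.\<close>

definition dn :: "real poly \<Rightarrow> real poly" where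
  "dn p = [:mass p:] - anti p"

lemma pderiv_sum: "pderiv (sum f A) = (\<Sum>i\<in>A. pderiv (f i))"
  by (induction A rule: infinite_finite_induct) (simp_all add: pderiv_add)

lemma pderiv_anti [simp]: "pderiv (anti p) = p"
proof -
  have "pderiv (anti p) = (\<Sum>i\<le>degree p. monom (coeff p i) i)"
    unfolding anti_def pderiv_sum
    by (intro sum.cong refl) (simp add: pderiv_monom)
  then show ?thesis
    by (simp add: poly_as_sum_of_monoms)
qed

lemma poly_anti_0 [simp]: "poly (anti p) 0 = 0"
  by (simp add: anti_def poly_sum poly_monom)

lemma anti_unique:
  assumes "pderiv q = p" "poly q 0 = 0"
  shows "anti p = q"
proof -
  have "pderiv (anti p - q) = 0"
    using assms by (simp add: pderiv_diff)
  then have "degree (anti p - q) = 0"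
    by (simp add: pderiv_eq_0_iff)
  then obtain a where "anti p - q = [:a:]"
    by (rule degree_eq_zeroE)
  moreover from this have "a = 0"
    using arg_cong [of _ _ "\<lambda>r. poly r 0"] assms(2)
    by (metis diff_0_right minus_diff_eq mult_zero_left add.right_neutral poly_0 poly_anti_0 poly_diff poly_pCons)
  ultimately show ?thesis
    by simp
qed

lemma pderiv_dn [simp]: "pderiv (dn p) = - p"
  by (simp add: dn_def pderiv_diff pderiv_pCons)

lemma poly_dn_1 [simp]: "poly (dn p) 1 = 0"
  by (simp add: dn_def mass_def)

lemma dn_unique:
  assumes "pderiv q = - p" "poly q 1 = 0"
  shows "dn p = q"
proof -
  have "anti p = [:poly q 0:] - q"
    by (rule anti_unique) (use assms in \<open>simp_all add: pderiv_diff pderiv_pCons\<close>)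
  then show ?thesis
    using assms(2) by (simp add: dn_def mass_def)
qed

lemma anti_0 [simp]: "anti 0 = 0"
  by (rule anti_unique) simp_all

lemma anti_add: "anti (p + q) = anti p + anti q"
  by (rule anti_unique) (simp_all add: pderiv_add)

lemma anti_smult: "anti (smult a p) = smult a (anti p)"
  by (rule anti_unique) (simp_all add: pderiv_smult)

lemma anti_sum: "anti (sum f A) = (\<Sum>i\<in>A. anti (f i))"
  by (rule anti_unique) (simp_all add: pderiv_sum poly_sum)

lemma mass_smult: "mass (smult a p) = a * mass p"
  by (simp add: mass_def anti_smult)

lemma mass_sum: "mass (sum f A) = (\<Sum>i\<in>A. mass (f i))"
  by (simp add: mass_def anti_sum poly_sum)

lemma anti_1: "anti 1 = [:0, 1:]"
  by (rule anti_unique) (simp_all add: pderiv_pCons)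

lemma mass_1 [simp]: "mass 1 = 1"
  by (simp add: mass_def anti_1)

lemma mass_const [simp]: "mass [:a:] = a"
  using mass_smult [of a 1] by simp

lemma dn_0 [simp]: "dn 0 = 0"
  by (rule dn_unique) simp_all

lemma dn_smult: "dn (smult a p) = smult a (dn p)"
  by (rule dn_unique) (simp_all add: pderiv_smult)

lemma dn_sum: "dn (sum f A) = (\<Sum>i\<in>A. dn (f i))"
  by (rule dn_unique) (simp_all add: pderiv_sum poly_sum sum_negf)

lemma anti_plus_dn: "anti p + dn p = [:mass p:]"
  by (simp add: dn_def)

section \<open>The pointwise order on the unit interval\<close>

definition ple :: "real poly \<Rightarrow> real poly \<Rightarrow> bool" (infix "\<preceq>" 50) where
  "p \<preceq> q \<longleftrightarrow> (\<forall>x\<in>{0..1}. poly p x \<le> poly q x)"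

lemma pleI: "(\<And>x. 0 \<le> x \<Longrightarrow> x \<le> 1 \<Longrightarrow> poly p x \<le> poly q x) \<Longrightarrow> p \<preceq> q"
  by (simp add: ple_def)

lemma pleD: "p \<preceq> q \<Longrightarrow> 0 \<le> x \<Longrightarrow> x \<le> 1 \<Longrightarrow> poly p x \<le> poly q x"
  by (simp add: ple_def)

lemma ple_refl [simp]: "p \<preceq> p"
  by (simp add: ple_def)

lemma ple_add: "p \<preceq> q \<Longrightarrow> r \<preceq> s \<Longrightarrow> p + r \<preceq> q + s"
  by (simp add: ple_def add_mono)

lemma poly_mono_pderiv:
  fixes p :: "real poly"
  assumes "0 \<preceq> pderiv p" "0 \<le> x" "x \<le> y" "y \<le> 1"
  shows "poly p x \<le> poly p y"
proof (rule DERIV_nonneg_imp_nondecreasing [OF assms(3)])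
  fix t assume "x \<le> t" "t \<le> y"
  then show "\<exists>z. DERIV (poly p) t :> z \<and> 0 \<le> z"
    using assms pleD [OF assms(1), of t] by (intro exI [of _ "poly (pderiv p) t"]) (auto intro: poly_DERIV)
qed

lemma anti_mono:
  assumes "p \<preceq> q"
  shows "anti p \<preceq> anti q"
proof (rule pleI)
  fix x :: real assume x: "0 \<le> x" "x \<le> 1"
  have "0 \<preceq> pderiv (anti q - anti p)"
    using assms by (simp add: pderiv_diff ple_def)
  from poly_mono_pderiv [OF this order_refl x] show "poly (anti p) x \<le> poly (anti q) x"
    by simp
qed

lemma mass_mono: "p \<preceq> q \<Longrightarrow> mass p \<le> mass q"
  using anti_mono [of p q] by (simp add: mass_def ple_def)

lemma dn_mono:
  assumes "p \<preceq> q"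
  shows "dn p \<preceq> dn q"
proof (rule pleI)
  fix x :: real assume x: "0 \<le> x" "x \<le> 1"
  have "0 \<preceq> pderiv (dn p - dn q)"
    using assms by (simp add: pderiv_diff ple_def)
  from poly_mono_pderiv [OF this x order_refl] show "poly (dn p) x \<le> poly (dn q) x"
    by simp
qed

lemma anti_nonneg: "0 \<preceq> p \<Longrightarrow> 0 \<preceq> anti p"
  using anti_mono [of 0 p] by simp

lemma dn_nonneg: "0 \<preceq> p \<Longrightarrow> 0 \<preceq> dn p"
  using dn_mono [of 0 p] by simp

text \<open>Chebyshev's integral inequality for \<open>p\<close> and the indicator of
  \<open>[0, x]\<close>.\<close>

lemma anti_le_of_mono:
  assumes "mono_on {0..1} (poly p)"
  shows "anti p \<preceq> smult (mass p) (anti 1)"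
proof (rule pleI)
  fix x :: real assume x: "0 \<le> x" "x \<le> 1"
  let ?A = "poly (anti p) x"
  \<comment> \<open>By the mean value theorem, \<open>p(x)\<close> lies between the averages of
    \<open>p\<close> over \<open>[0, x]\<close> and over \<open>[x, 1]\<close>.\<close>
  have left: "?A \<le> x * poly p x"
  proof (cases "x = 0")
    case False
    then obtain z where "0 < z" "z < x" "?A = x * poly p z"
      using poly_MVT [of 0 x "anti p"] x by auto
    moreover from this have "poly p z \<le> poly p x"
      using x by (intro mono_onD [OF assms]) auto
    ultimately show ?thesis
      using x by (simp add: mult_left_mono)
  qed simp
  have right: "(1 - x) * poly p x \<le> mass p - ?A"
  proof (cases "x = 1")
    case False
    then obtain z where "x < z" "z < 1" "mass p - ?A = (1 - x) * poly p z"
      using poly_MVT [of x 1 "anti p"] x by (auto simp: mass_def)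
    moreover from this have "poly p x \<le> poly p z"
      using x by (intro mono_onD [OF assms]) auto
    ultimately show ?thesis
      using x by (simp add: mult_left_mono)
  qed (simp add: mass_def)
  \<comment> \<open>Adding \<open>1 - x\<close> times the first bound to \<open>x\<close> times the
    second eliminates \<open>poly p x\<close>.\<close>
  have "?A = x * ?A + (1 - x) * ?A"
    by (simp add: algebra_simps)
  also have "\<dots> \<le> x * ?A + (1 - x) * (x * poly p x)"
    using left x by (intro add_left_mono mult_left_mono) auto
  also have "\<dots> = x * (?A + (1 - x) * poly p x)"
    by (simp add: algebra_simps)
  also have "\<dots> \<le> x * mass p"
    using right x by (intro mult_left_mono) auto
  finally show "?A \<le> poly (smult (mass p) (anti 1)) x"
    by (simp add: anti_1 mult.commute)
qed

text \<open>Apply \<open>anti_le_of_mono\<close> to \<open>- p\<close>; subtraction from the total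
  mass turns \<open>anti\<close> into \<open>dn\<close>.\<close>

lemma dn_le_of_antimono:
  assumes "antimono_on {0..1} (poly p)"
  shows "dn p \<preceq> smult (mass p) (dn 1)"
proof -
  have "mono_on {0..1} (poly (smult (- 1) p))"
    using assms by (simp add: monotone_on_def)
  from anti_le_of_mono [OF this] have "smult (- 1) (anti p) \<preceq> smult (- mass p) (anti 1)"
    by (simp only: anti_smult mass_smult mult_minus1)
  then show ?thesis
    by (simp add: ple_def dn_def anti_1 algebra_simps)
qed

lemma antimono_dn:
  assumes "0 \<preceq> p"
  shows "antimono_on {0..1} (poly (dn p))"
proof (rule monotone_onI)
  fix x y :: real assume xy: "x \<in> {0..1}" "y \<in> {0..1}" "x \<le> y"
  have "0 \<preceq> pderiv (- dn p)"
    using assms by (simp add: pderiv_minus)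
  from poly_mono_pderiv [OF this _ xy(3)] xy show "poly (dn p) y \<le> poly (dn p) x"
    by simp
qed

text \<open>
  Let the entries of the word be independent and uniform on \<open>[0, 1]\<close>, and describe a prefix by the pair
  \<open>(u, d)\<close> of the densities, as functions of its last entry, of the prefixes that end with an ascent
  and of those that do not. If the last position of the prefix is not going to be a peak, then
  appending an entry turns \<open>(u, d)\<close> into \<open>(anti (u + d), dn d)\<close>; if it is, into \<open>(0, dn u)\<close>.
  After \<open>m\<close> steps without a peak \<open>(0, d)\<close> has become \<open>(ups m d, (dn ^^ m) d)\<close>.
\<close>

primrec ups :: "nat \<Rightarrow> real poly \<Rightarrow> real poly" where
  "ups 0 d = 0"
| "ups (Suc m) d = anti (ups m d + (dn ^^ m) d)"

abbreviation tot :: "nat \<Rightarrow> real poly \<Rightarrow> real poly" where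
  "tot m d \<equiv> ups m d + (dn ^^ m) d"

text \<open>
  The state after a peak is \<open>(0, d)\<close>, and so is the state \<open>(0, 1)\<close> at the first position. Hence
  \<open>val d c\<close> is the total mass after reading the parts \<open>c\<close> from \<open>(0, d)\<close>. A first or an inner part
  equal to \<open>1\<close> gives \<open>0\<close>, in accordance with the count.
\<close>

fun val :: "real poly \<Rightarrow> nat list \<Rightarrow> real" where
  "val d [] = mass d"
| "val d [h] = mass (tot (h - 1) d)"
| "val d (g # v) = val (dn (ups (g - 1) d)) v"

section \<open>Linearity and monotonicity of the transfer\<close>

lemma val_Cons: "v \<noteq> [] \<Longrightarrow> val d (g # v) = val (dn (ups (g - 1) d)) v"
  by (cases v) auto

lemma funpow_dn_mono: "d \<preceq> e \<Longrightarrow> (dn ^^ m) d \<preceq> (dn ^^ m) e"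
  by (induction m) (auto intro: dn_mono)

lemma ups_mono: "d \<preceq> e \<Longrightarrow> ups m d \<preceq> ups m e"
  by (induction m) (auto intro: anti_mono ple_add funpow_dn_mono)

lemma val_mono: "d \<preceq> e \<Longrightarrow> val d c \<le> val e c"
  by (induction d c arbitrary: e rule: val.induct)
    (auto intro: mass_mono ple_add ups_mono funpow_dn_mono dn_mono)

lemma funpow_dn_smult: "(dn ^^ m) (smult a d) = smult a ((dn ^^ m) d)"
  by (induction m) (auto simp: dn_smult)

lemma ups_smult: "ups m (smult a d) = smult a (ups m d)"
  by (induction m) (auto simp: funpow_dn_smult anti_smult smult_add_right [symmetric])

lemma val_smult: "val (smult a d) c = a * val d c"
proof (induction d c rule: val.induct)
  case (2 d h)
  show ?case
    by (simp add: funpow_dn_smult ups_smult mass_smult smult_add_right [symmetric])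
qed (simp_all add: mass_smult ups_smult dn_smult)

lemma ups_nonneg: "0 \<preceq> d \<Longrightarrow> 0 \<preceq> ups m d"
  using ups_mono [of 0 d m] ups_smult [of m 0 0] by simp

lemma val_nonneg: "0 \<preceq> d \<Longrightarrow> 0 \<le> val d c"
  using val_mono [of 0 d c] val_smult [of 0 0 c] by simp

section \<open>Closed forms for a uniform start\<close>

lemma pderiv_linear_power:
  "pderiv ([:1, a:] ^ Suc m) = smult (real (Suc m) * a) ([:1, a:] ^ m)"
  by (simp add: pderiv_power_Suc pderiv_pCons mult.commute del: power_Suc of_nat_Suc)

text \<open>The volume of the decreasing chains of \<open>m\<close> points above
  \<open>x\<close>.\<close>

lemma funpow_dn_one: "(dn ^^ m) 1 = smult (1 / fact m) ([:1, -1:] ^ m)"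
proof (induction m)
  case (Suc m)
  have *: "1 / fact (Suc m) * (real (Suc m) * - 1) = - (1 / fact m)"
    by (simp add: divide_simps)
  show ?case
    unfolding funpow.simps o_def Suc
    by (intro dn_unique)
      (simp_all only: pderiv_smult pderiv_linear_power smult_smult * smult_minus_left, simp)
qed simp

text \<open>Kept apart from \<open>ups_one\<close>, whose induction step integrates
  \<open>tot m 1\<close> and gets it from the induction hypothesis in this way.\<close>

lemma tot_one_if_ups_one:
  assumes "ups m 1 = smult (1 / (2 * fact m)) ([:1, 1:] ^ m - [:1, -1:] ^ m)"
  shows "tot m 1 = smult (1 / (2 * fact m)) ([:1, 1:] ^ m + [:1, -1:] ^ m)"
proof -
  have "(1 :: real) / fact m = 1 / (2 * fact m) + 1 / (2 * fact m)"
    by simp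
  then show ?thesis
    unfolding assms funpow_dn_one
    by (simp only: smult_add_left smult_add_right smult_diff_right)
qed

lemma ups_one: "ups m 1 = smult (1 / (2 * fact m)) ([:1, 1:] ^ m - [:1, -1:] ^ m)"
proof (induction m)
  case (Suc m)
  have *: "1 / (2 * fact (Suc m)) * (real (Suc m) * a) = 1 / (2 * fact m) * a" for a :: real
    by (simp add: divide_simps)
  have "pderiv (smult (1 / (2 * fact (Suc m)) :: real) ([:1, 1:] ^ Suc m - [:1, -1:] ^ Suc m))
      = smult (1 / (2 * fact m)) ([:1, 1:] ^ m + [:1, -1:] ^ m)"
    unfolding pderiv_smult pderiv_diff pderiv_linear_power smult_diff_right smult_smult *
    by (simp add: smult_add_right)
  then show ?case
    unfolding ups.simps tot_one_if_ups_one [OF Suc] by (intro anti_unique) simp_all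
qed simp

lemma val_single: "0 < h \<Longrightarrow> val 1 [h] = 2 ^ (h - 1) / fact h"
proof -
  assume "0 < h"
  then obtain m where m: "h = Suc m" by (cases h) auto
  \<comment> \<open>\<open>ups h 1\<close> is the antiderivative of \<open>tot m 1\<close>, so its
    value at 1 is the mass; the power of \<open>1 - x\<close> vanishes there as
    \<open>0 < h\<close>.\<close>
  have "val 1 [h] = poly (ups h 1) 1"
    by (simp add: m mass_def)
  also have "\<dots> = 2 ^ h / (2 * fact h)"
    using \<open>0 < h\<close> by (simp add: ups_one poly_power zero_power)
  finally show ?thesis
    by (simp add: m)
qed

section \<open>Comparison of a decreasing start with a uniform one\<close>

lemma funpow_dn_le_mass:
  assumes "antimono_on {0..1} (poly d)" "0 < m"
  shows "(dn ^^ m) d \<preceq> smult (mass d) ((dn ^^ m) 1)"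
  using assms(2)
proof (induction m rule: nat_induct_non_zero)
  case 1
  then show ?case
    using dn_le_of_antimono [OF assms(1)] by simp
next
  case (Suc m)
  then show ?case
    using dn_mono [OF Suc.IH] by (simp add: dn_smult)
qed

text \<open>A step in either direction gives the constant \<open>anti d + dn d\<close>: the new
  entry is uniform and remembers only the mass of \<open>d\<close>.\<close>

lemma ups_two: "ups 2 d = smult (mass d) (anti 1)"
  by (simp add: numeral_2_eq_2 anti_plus_dn flip: anti_smult)

text \<open>For \<open>m = 1\<close> a decreasing \<open>d\<close> gives the reverse inequality. At
  \<open>m = 2\<close> there is equality by \<open>ups_two\<close>, and integration preserves the
  bound from there on.\<close>

lemma ups_le_mass:
  assumes "antimono_on {0..1} (poly d)" "2 \<le> m"
  shows "ups m d \<preceq> smult (mass d) (ups m 1)"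
  using assms(2)
proof (induction m rule: nat_induct_at_least)
  case base
  then show ?case
    by (simp add: ups_two)
next
  case (Suc m)
  have "tot m d \<preceq> smult (mass d) (tot m 1)"
    unfolding smult_add_right using Suc
    by (intro ple_add funpow_dn_le_mass assms) auto
  from anti_mono [OF this] show ?case
    by (simp add: anti_smult)
qed

lemma mass_tot_le:
  assumes "antimono_on {0..1} (poly d)" "0 < m"
  shows "mass (tot m d) \<le> mass d * mass (tot m 1)"
proof -
  \<comment> \<open>The mass of \<open>tot m d\<close> is the value of \<open>ups (Suc m) d\<close>
    at 1, so \<open>m = 1\<close> already meets the threshold 2 of
    \<open>ups_le_mass\<close>.\<close>
  have "ups (Suc m) d \<preceq> smult (mass d) (ups (Suc m) 1)"
    using assms by (intro ups_le_mass) auto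
  from pleD [OF this, of 1] show ?thesis
    by (simp add: mass_def)
qed

text \<open>
  The density of an entry that follows a peak is decreasing. Replacing it by the uniform density of
  the same mass can only favour the absence of peaks in the next valley, as soon as this valley has
  another element. This decouples the two sides of a part \<open>g \<ge> 3\<close>.
\<close>

lemma val_Cons_le:
  assumes "antimono_on {0..1} (poly d)" "0 \<preceq> d" "2 \<le> g" "3 \<le> g \<or> v = []"
  shows "val d (g # v) \<le> mass d * val 1 (g # v)"
proof (cases "v = []")
  case True
  then show ?thesis
    using mass_tot_le [OF assms(1), of "g - 1"] assms by simp
next
  case False
  then have "dn (ups (g - 1) d) \<preceq> smult (mass d) (dn (ups (g - 1) 1))"
    using assms dn_mono [OF ups_le_mass [OF assms(1), of "g - 1"]] by (simp add: dn_smult)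
  from val_mono [OF this, of v] False show ?thesis
    by (simp add: val_Cons val_smult)
qed

section \<open>Cutting a composition at one of its parts\<close>

fun run :: "real poly \<Rightarrow> nat list \<Rightarrow> real poly" where
  "run d [] = d"
| "run d (g # v) = run (dn (ups (g - 1) d)) v"

lemma val_append: "v \<noteq> [] \<Longrightarrow> val d (u @ v) = val (run d u) v"
  by (induction u arbitrary: d) (simp_all add: val_Cons)

lemma run_nonneg: "0 \<preceq> d \<Longrightarrow> 0 \<preceq> run d u"
  by (induction u arbitrary: d) (auto intro: ups_nonneg dn_nonneg)

lemma antimono_run:
  "u \<noteq> [] \<Longrightarrow> 0 \<preceq> d \<Longrightarrow> antimono_on {0..1} (poly (run d u))"
proof (induction u arbitrary: d)
  case (Cons g u)
  show ?case
  proof (cases "u = []")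
    case True
    then show ?thesis using Cons.prems by (simp add: antimono_dn ups_nonneg)
  next
    case False
    then show ?thesis using Cons by (simp add: dn_nonneg ups_nonneg)
  qed
qed simp

lemma zero_ple_1 [simp]: "0 \<preceq> 1"
  by (simp add: ple_def)

abbreviation density :: "nat list \<Rightarrow> real" where
  "density c \<equiv> val 1 c"

lemma mass_run: "mass (run 1 u) = density (u @ [1])"
  by (simp add: val_append)

text \<open>The entry after a peak cannot be a peak, so one more final entry may go either
  way.\<close>

lemma density_append_2: "density (u @ [2]) = density (u @ [1])"
  by (simp add: val_append anti_plus_dn)

text \<open>\<open>val_Cons_le\<close> for the density after the prefix \<open>u\<close>. Its mass
  is written with a final 2 instead of 1 because the bound used in the induction decreases with the
  length.\<close>

lemma density_split_le:
  assumes "u \<noteq> []" "2 \<le> g" "3 \<le> g \<or> v = []"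
  shows "density (u @ g # v) \<le> density (u @ [2]) * density (g # v)"
  using val_Cons_le [OF antimono_run [OF assms(1) zero_ple_1] run_nonneg [OF zero_ple_1] assms(2,3)]
  by (simp only: density_append_2 mass_run val_append [of "g # v"] list.distinct not_False_eq_True)

text \<open>A part 3 has one step of free direction, which by \<open>ups_two\<close> erases all
  memory except the mass.\<close>

lemma density_split_3:
  assumes "v \<noteq> []"
  shows "density (u @ 3 # v) = density (u @ [2]) * density (3 # v)"
  using assms by (simp add: density_append_2 val_append val_Cons ups_two dn_smult val_smult del: ups.simps(2))

text \<open>A first part 3 is a first part 2 with a free entry in front.\<close>

lemma density_2_Cons: "v \<noteq> [] \<Longrightarrow> density (2 # v) = density (3 # v)"
  by (simp add: val_Cons ups_two)

text \<open>In the derivative the descending terms cancel and \<open>ups m 1\<close> is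
  left.\<close>

lemma mono_tot_one: "mono_on {0..1} (poly (tot (Suc m) 1))"
proof (rule monotone_onI)
  fix x y :: real assume xy: "x \<in> {0..1}" "y \<in> {0..1}" "x \<le> y"
  have "0 \<preceq> pderiv (tot (Suc m) 1)"
    by (simp add: pderiv_add ups_nonneg)
  from poly_mono_pderiv [OF this _ xy(3)] xy show "poly (tot (Suc m) 1) x \<le> poly (tot (Suc m) 1) y"
    by simp
qed

text \<open>The density before the ascent to the first peak is increasing. Replacing it by a uniform
  one of mass \<open>density [a - 1]\<close> leaves a first part 2.\<close>

lemma density_Cons_le:
  assumes "3 \<le> a" "v \<noteq> []"
  shows "density (a # v) \<le> density [a - 1] * density (3 # v)"
proof -
  obtain m where m: "a = Suc (Suc (Suc m))"
    using assms(1) by (auto simp: le_iff_add numeral_3_eq_3)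
  have "ups (a - 1) 1 \<preceq> smult (density [a - 1]) (ups 1 1)"
    using anti_le_of_mono [OF mono_tot_one [of m]] by (simp add: m del: funpow.simps)
  from val_mono [OF dn_mono [OF this], of v]
  have "density (a # v) \<le> density [a - 1] * density (2 # v)"
    using assms(2) by (simp add: val_Cons dn_smult val_smult del: val.simps ups.simps)
  then show ?thesis
    using assms(2) by (simp add: density_2_Cons)
qed

lemma density_nonneg: "0 \<le> density c"
  by (simp add: val_nonneg)

lemma density_part_1: "v \<noteq> [] \<Longrightarrow> density (u @ 1 # v) = 0"
  using val_smult [of 0 0 v] by (simp add: val_append val_Cons)

section \<open>Explicit values and alternating words\<close>

lemma dn_anti_1: "dn (anti 1) = [:1/2, 0, -1/2:]"
  unfolding anti_1 by (rule dn_unique) (simp_all add: pderiv_pCons)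

lemma anti_dn_anti_1: "anti (dn (anti 1)) = [:0, 1/2, 0, -1/6:]"
  unfolding dn_anti_1 by (rule anti_unique) (simp_all add: pderiv_pCons)

lemma dn_anti_dn_anti_1: "dn (anti (dn (anti 1))) = [:5/24, 0, -1/4, 0, 1/24:]"
  unfolding anti_dn_anti_1 by (rule dn_unique) (simp_all add: pderiv_pCons)

lemma mass_dn_anti_1: "mass (dn (anti 1)) = 1 / 3"
  by (simp add: mass_def anti_dn_anti_1)

lemma mass_dn_anti_dn_anti_1: "mass (dn (anti (dn (anti 1)))) = 2 / 15"
proof -
  have "anti (dn (anti (dn (anti 1)))) = [:0, 5/24, 0, -1/12, 0, 1/120:]"
    unfolding dn_anti_dn_anti_1 by (rule anti_unique) (simp_all add: pderiv_pCons)
  then show ?thesis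
    by (simp add: mass_def)
qed

lemma density_3_3: "density [3, 3] = 1 / 5"
proof -
  have dd: "dn (dn [:1/2, 0, -1/2:]) = [:1/8, -1/3, 1/4, 0, -1/24:]"
  proof -
    have *: "dn [:1/2, 0, -1/2:] = [:1/3, -1/2, 0, 1/6:]"
      by (rule dn_unique) (simp_all add: pderiv_pCons)
    show ?thesis
      unfolding * by (rule dn_unique) (simp_all add: pderiv_pCons)
  qed
  have "density [3, 3] = density [2, 3]"
    by (simp add: density_2_Cons del: val.simps)
  also have "\<dots> = mass (tot 2 (dn (anti 1)))"
    by (simp del: ups.simps(2) add: ups_two, simp)
  also have "\<dots> = poly (anti ([:1/8, 0, 1/4, 0, -1/24:])) 1"
    unfolding ups_two mass_dn_anti_1 unfolding dn_anti_1 unfolding anti_1 mass_def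
    by (simp add: numeral_2_eq_2 dd [simplified])
  also have "anti [:1/8, 0, 1/4, 0, -1/24:] = [:0, 1/8, 0, 1/12, 0, -1/120:]"
    by (rule anti_unique) (simp_all add: pderiv_pCons)
  finally show ?thesis
    by simp
qed

lemma density_4_2: "density [4, 2] = 1 / 5"
proof -
  have "ups 3 1 = [:0, 1/2, 0, 1/6:]"
    by (simp add: ups_one eval_nat_numeral)
  moreover have "dn [:0, 1/2, 0, 1/6:] = [:7/24, 0, -1/4, 0, -1/24:]"
    by (rule dn_unique) (simp_all add: pderiv_pCons)
  moreover have "anti [:7/24, 0, -1/4, 0, -1/24:] = [:0, 7/24, 0, -1/12, 0, -1/120:]"
    by (rule anti_unique) (simp_all add: pderiv_pCons)
  moreover have "density [4, 2] = density [4, 1]"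
    using density_append_2 [of "[4]"] by (simp del: val.simps)
  ultimately show ?thesis
    by (simp add: mass_def)
qed

text \<open>Equal to \<open>E\<^bsub>2k+3\<^esub> / (2k+3)!\<close> for the tangent numbers \<open>E\<close>.\<close>

definition alt :: "nat \<Rightarrow> real" where
  "alt k = density (2 # replicate k 2 @ [1])"

lemma alt_0: "alt 0 = 1 / 3" and alt_1: "alt 1 = 2 / 15"
  by (simp_all add: alt_def mass_dn_anti_1 mass_dn_anti_dn_anti_1)

text \<open>The density \<open>(1 - x^2) / 2\<close> after a first part 2 is at most its value at
  0.\<close>

lemma alt_Suc: "alt (Suc k) \<le> 1 / 2 * alt k"
proof -
  have "dn (anti 1) \<preceq> smult (1 / 2) 1"
    by (simp add: dn_anti_1 ple_def)
  then have "dn (anti (dn (anti 1))) \<preceq> smult (1 / 2) (dn (anti 1))"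
    using dn_mono anti_mono by (metis dn_smult anti_smult)
  from val_mono [OF this, of "replicate k 2 @ [1]"] show ?thesis
    by (simp add: alt_def val_Cons val_smult)
qed

text \<open>The constant is the value at 0 of the density after two parts 2; it improves on the 1/4
  from two uses of \<open>alt_Suc\<close>.\<close>

lemma alt_Suc_Suc: "alt (Suc (Suc k)) \<le> 5 / 24 * alt k"
proof -
  have "dn (anti (dn (anti 1))) \<preceq> smult (5 / 24) 1"
  proof (rule pleI)
    fix x :: real assume x: "0 \<le> x" "x \<le> 1"
    have "poly (dn (anti (dn (anti 1)))) x = 5 / 24 - x\<^sup>2 * (6 - x\<^sup>2) / 24"
      unfolding dn_anti_dn_anti_1 by (simp add: field_simps power2_eq_square)
    moreover have "x\<^sup>2 \<le> 6"
      using power_mono [OF x(2,1), of 2] by simp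
    ultimately show "poly (dn (anti (dn (anti 1)))) x \<le> poly (smult (5 / 24) 1) x"
      by simp
  qed
  then have "dn (anti (dn (anti (dn (anti 1))))) \<preceq> smult (5 / 24) (dn (anti 1))"
    using dn_mono anti_mono by (metis dn_smult anti_smult)
  from val_mono [OF this, of "replicate k 2 @ [1]"] show ?thesis
    by (simp add: alt_def val_Cons val_smult)
qed

section \<open>Counting permutations by their last value\<close>

text \<open>
  The density of the \<open>(k + 1)\<close>-st smallest of \<open>m + 1\<close> uniform points, divided by \<open>(m + 1)!\<close>: the weight
  of a permutation of \<open>{1..m + 1}\<close> whose last value is \<open>k + 1\<close>.
\<close>

definition bern :: "nat \<Rightarrow> nat \<Rightarrow> real poly" where
  "bern m k = smult (1 / (fact k * fact (m - k))) ([:0, 1:] ^ k * [:1, -1:] ^ (m - k))"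

text \<open>The case distinction is due to truncated subtraction, which makes
  \<open>bern m (Suc m)\<close> nonzero.\<close>

lemma pderiv_bern:
  shows "k \<le> m \<Longrightarrow> pderiv (bern (Suc m) (Suc k)) = bern m k - (if k < m then bern m (Suc k) else 0)"
    and "pderiv (bern (Suc m) 0) = - bern m 0"
proof -
  have X: "pderiv ([:0, 1:] ^ Suc k) = smult (real (Suc k)) ([:0, 1:] ^ k)" for k
    by (simp add: pderiv_power_Suc pderiv_pCons del: power_Suc of_nat_Suc)
  have Y: "pderiv ([:1, -1:] ^ Suc j) = smult (- real (Suc j)) ([:1, -1:] ^ j)" for j
    using pderiv_linear_power [of "-1" j] by (simp only: mult_minus1_right)
  show "pderiv (bern (Suc m) 0) = - bern m 0"
  proof -
    have "1 / fact (Suc m) * - real (Suc m) = - (1 / fact m)"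
      by (simp add: divide_simps)
    then show ?thesis
      unfolding bern_def pderiv_smult diff_zero power_0 mult_1_left fact_0 Y smult_smult by simp
  qed
  show "pderiv (bern (Suc m) (Suc k)) = bern m k - (if k < m then bern m (Suc k) else 0)" if "k \<le> m"
  proof (cases "k < m")
    case True
    then obtain j where j: "m - k = Suc j" "Suc m - Suc k = Suc j" "m - Suc k = j"
      by (metis Suc_diff_Suc diff_Suc_Suc)
    have 1: "1 / (fact (Suc k) * fact (Suc j)) * real (Suc k) = 1 / (fact k * fact (Suc j))"
      and 2: "1 / (fact (Suc k) * fact (Suc j)) * - real (Suc j) = - (1 / (fact (Suc k) * fact j))"
      by (simp_all add: divide_simps del: of_nat_Suc)
    show ?thesis
      unfolding bern_def j pderiv_smult pderiv_mult X Y
      unfolding mult_smult_right smult_add_right smult_smult 1 2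
      using True j by (simp add: mult.commute del: power_Suc fact_Suc of_nat_Suc)
  next
    case False
    then have "k = m"
      using that by simp
    moreover have "1 / fact (Suc m) * real (Suc m) = 1 / fact m"
      by (simp add: divide_simps)
    ultimately show ?thesis
      by (simp only: bern_def pderiv_smult diff_self_eq_0 power_0 mult_1_right X smult_smult fact_0) simp
  qed
qed

lemma pderiv_sum_bern: "j \<le> m \<Longrightarrow> pderiv (\<Sum>k\<le>j. bern (Suc m) k) = - bern m j"
  by (induction j) (simp_all add: pderiv_add pderiv_bern)

text \<open>The derivatives telescope and every summand vanishes at 1. Combinatorially, a descent
  from the last value \<open>j + 1\<close> leads to a last value \<open>k + 1\<close> with
  \<open>k \<le> j\<close>.\<close>

lemma dn_bern: "j \<le> m \<Longrightarrow> dn (bern m j) = (\<Sum>k\<le>j. bern (Suc m) k)"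
  by (rule dn_unique) (simp add: pderiv_sum_bern, auto simp: poly_sum bern_def intro!: sum.neutral)

text \<open>The sum over all \<open>k\<close> is constant, so the terms complementary to
  \<open>dn_bern\<close> form the antiderivative.\<close>

lemma anti_bern:
  assumes "j \<le> m"
  shows "anti (bern m j) = (\<Sum>k\<in>{j<..Suc m}. bern (Suc m) k)"
proof (rule anti_unique)
  have "{..Suc m} = {..j} \<union> {j<..Suc m}"
    using assms by auto
  then have "(\<Sum>k\<le>Suc m. bern (Suc m) k)
      = (\<Sum>k\<le>j. bern (Suc m) k) + (\<Sum>k\<in>{j<..Suc m}. bern (Suc m) k)"
    by (simp only:) (rule sum.union_disjoint, auto)
  moreover have "pderiv (\<Sum>k\<le>Suc m. bern (Suc m) k) = 0"
    by (simp add: pderiv_add pderiv_sum_bern pderiv_bern)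
  ultimately show "pderiv (\<Sum>k\<in>{j<..Suc m}. bern (Suc m) k) = bern m j"
    using pderiv_sum_bern [OF assms] by (simp add: pderiv_add)
  show "poly (\<Sum>k\<in>{j<..Suc m}. bern (Suc m) k) 0 = 0"
    by (auto simp: poly_sum bern_def intro!: sum.neutral)
qed

lemma mass_bern:
  assumes "j \<le> m"
  shows "mass (bern m j) = 1 / fact (Suc m)"
proof -
  have "mass (bern m j) = (\<Sum>k\<in>{j<..Suc m}. poly (bern (Suc m) k) 1)"
    by (simp add: mass_def anti_bern assms poly_sum)
  also have "\<dots> = (\<Sum>k\<in>{Suc m}. poly (bern (Suc m) k) 1)"
    using assms by (intro sum.mono_neutral_right) (auto simp: bern_def)
  finally show ?thesis
    by (simp add: bern_def)
qed

section \<open>Appending a last value to a permutation\<close>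

definition insert_last :: "nat \<Rightarrow> (nat \<Rightarrow> nat) \<Rightarrow> nat \<Rightarrow> nat \<Rightarrow> nat" where
  "insert_last n \<tau> i k =
     (if k = Suc n then i else if k \<in> {1..n} \<and> i \<le> \<tau> k then Suc (\<tau> k) else \<tau> k)"

lemma insert_last_less_iff:
  "k \<in> {1..n} \<Longrightarrow> l \<in> {1..n} \<Longrightarrow> insert_last n \<tau> i k < insert_last n \<tau> i l \<longleftrightarrow> \<tau> k < \<tau> l"
  by (auto simp: insert_last_def)

lemma insert_last_less_last_iff:
  "k \<in> {1..n} \<Longrightarrow> insert_last n \<tau> i k < insert_last n \<tau> i (Suc n) \<longleftrightarrow> \<tau> k < i"
  "k \<in> {1..n} \<Longrightarrow> insert_last n \<tau> i (Suc n) < insert_last n \<tau> i k \<longleftrightarrow> i \<le> \<tau> k"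
  by (auto simp: insert_last_def)

lemma insert_last_permutes:
  assumes "\<tau> permutes {1..n}" "i \<in> {1..Suc n}"
  shows "insert_last n \<tau> i permutes {1..Suc n}"
proof -
  have mem: "\<tau> k \<in> {1..n}" if "k \<in> {1..n}" for k
    using permutes_in_image [OF assms(1)] that by blast
  have "inj_on (insert_last n \<tau> i) {1..Suc n}"
  proof (rule inj_onI)
    fix k l assume "k \<in> {1..Suc n}" "l \<in> {1..Suc n}" "insert_last n \<tau> i k = insert_last n \<tau> i l"
    moreover have "k = l" if "\<tau> k = \<tau> l"
      using that permutes_inj [OF assms(1)] by (simp add: inj_eq)
    ultimately show "k = l"
      by (auto simp: insert_last_def split: if_splits)
  qed
  moreover have "insert_last n \<tau> i ` {1..Suc n} \<subseteq> {1..Suc n}"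
    using assms(2) mem by (fastforce simp: insert_last_def)
  ultimately have "bij_betw (insert_last n \<tau> i) {1..Suc n} {1..Suc n}"
    by (simp add: bij_betw_def endo_inj_surj)
  moreover have "insert_last n \<tau> i k = k" if "k \<notin> {1..Suc n}" for k
    using that permutes_not_in [OF assms(1), of k] by (auto simp: insert_last_def)
  ultimately show ?thesis
    by (rule bij_imp_permutes)
qed

text \<open>Surjectivity follows from injectivity and
  \<open>n! * (n + 1) = (n + 1)!\<close>.\<close>

lemma bij_betw_insert_last:
  "bij_betw (\<lambda>(\<tau>, i). insert_last n \<tau> i) ({\<tau>. \<tau> permutes {1..n}} \<times> {1..Suc n})
     {\<sigma>. \<sigma> permutes {1..Suc n}}" (is "bij_betw ?f ?A ?B")
proof -
  have "inj_on ?f ?A"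
  proof (rule inj_onI, clarify)
    fix \<tau> i \<tau>' i'
    assume perm: "\<tau> permutes {1..n}" "\<tau>' permutes {1..n}"
      and eq: "insert_last n \<tau> i = insert_last n \<tau>' i'"
    from fun_cong [OF eq, of "Suc n"] have "i = i'"
      by (simp add: insert_last_def)
    moreover have "\<tau> k = \<tau>' k" for k
    proof (cases "k \<in> {1..n}")
      case True
      then show ?thesis
        using fun_cong [OF eq, of k] \<open>i = i'\<close> by (auto simp: insert_last_def split: if_splits)
    next
      case False
      then show ?thesis
        using perm by (simp add: permutes_not_in)
    qed
    ultimately show "\<tau> = \<tau>' \<and> i = i'"
      by auto
  qed
  moreover have "?f ` ?A \<subseteq> ?B"
    using insert_last_permutes by auto
  moreover have "card ?A = card ?B"
    by (simp add: card_cartesian_product card_permutations [OF refl] mult.commute)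
  moreover have "finite ?B"
    by (rule finite_permutations) simp
  ultimately show ?thesis
    by (simp add: bij_betw_def card_image card_subset_eq)
qed

lemma sum_permutes_Suc:
  "(\<Sum>\<sigma> | \<sigma> permutes {1..Suc n}. f \<sigma>)
     = (\<Sum>\<tau> | \<tau> permutes {1..n}. \<Sum>i\<in>{1..Suc n}. f (insert_last n \<tau> i))"
  using sum.reindex_bij_betw [OF bij_betw_insert_last, of f n]
  by (simp add: sum.cartesian_product case_prod_unfold del: sum.cl_ivl_Suc)

section \<open>Peak sets and densities of prefixes\<close>

definition ends_up :: "nat \<Rightarrow> (nat \<Rightarrow> nat) \<Rightarrow> bool" where
  "ends_up m \<sigma> \<longleftrightarrow> 0 < m \<and> \<sigma> m < \<sigma> (Suc m)"

lemma ends_up_insert_last: "ends_up (Suc m) (insert_last (Suc m) \<tau> i) \<longleftrightarrow> \<tau> (Suc m) < i"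
  by (simp add: ends_up_def insert_last_less_last_iff)

text \<open>The order of the old entries is kept, so only position \<open>Suc m\<close>, which gains
  a right neighbour, can change its status.\<close>

lemma peak_set_insert_last:
  "peak_set (Suc (Suc m)) (insert_last (Suc m) \<tau> i) =
     peak_set (Suc m) \<tau> \<union> (if ends_up m \<tau> \<and> i \<le> \<tau> (Suc m) then {Suc m} else {})"
proof (rule set_eqI)
  fix k
  let ?\<sigma> = "insert_last (Suc m) \<tau> i"
  consider "k \<notin> {1<..Suc m}" | "1 < k" "k < Suc m" | "k = Suc m" "0 < m"
    by force
  then show "k \<in> peak_set (Suc (Suc m)) ?\<sigma> \<longleftrightarrow>
      k \<in> peak_set (Suc m) \<tau> \<union> (if ends_up m \<tau> \<and> i \<le> \<tau> (Suc m) then {Suc m} else {})"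
  proof cases
    case 1
    then show ?thesis
      by (auto simp: peak_set_def ends_up_def)
  next
    case 2
    then have "?\<sigma> (k - 1) < ?\<sigma> k \<longleftrightarrow> \<tau> (k - 1) < \<tau> k" "?\<sigma> (k + 1) < ?\<sigma> k \<longleftrightarrow> \<tau> (k + 1) < \<tau> k"
      by (intro insert_last_less_iff; auto)+
    then show ?thesis
      using 2 by (auto simp: peak_set_def)
  next
    case 3
    then have "?\<sigma> m < ?\<sigma> (Suc m) \<longleftrightarrow> \<tau> m < \<tau> (Suc m)" "?\<sigma> (Suc (Suc m)) < ?\<sigma> (Suc m) \<longleftrightarrow> i \<le> \<tau> (Suc m)"
      by (intro insert_last_less_iff insert_last_less_last_iff; auto)+
    then show ?thesis
      using 3 by (auto simp: peak_set_def ends_up_def)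
  qed
qed

lemma peak_set_subset: "peak_set (Suc m) \<sigma> \<subseteq> {1..<Suc m}"
  by (auto simp: peak_set_def)

lemma peak_set_insert_last_eq_iff:
  "peak_set (Suc (Suc m)) (insert_last (Suc m) \<tau> i) = S \<inter> {1..<Suc (Suc m)} \<longleftrightarrow>
     peak_set (Suc m) \<tau> = S \<inter> {1..<Suc m} \<and> (Suc m \<in> S \<longleftrightarrow> ends_up m \<tau> \<and> i \<le> \<tau> (Suc m))"
proof -
  have "S \<inter> {1..<Suc (Suc m)} = (S \<inter> {1..<Suc m}) \<union> (if Suc m \<in> S then {Suc m} else {})"
    by (auto simp: less_Suc_eq)
  moreover have "Suc m \<notin> peak_set (Suc m) \<tau>"
    using peak_set_subset [of m \<tau>] by auto
  ultimately show ?thesis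
    unfolding peak_set_insert_last
    by (cases "Suc m \<in> S"; cases "ends_up m \<tau> \<and> i \<le> \<tau> (Suc m)") (auto simp: insert_ident)
qed

text \<open>The index counts steps: \<open>state S m\<close> belongs to prefixes of length
  \<open>m + 1\<close>, and the next step decides whether their last position is a peak.\<close>

primrec state :: "nat set \<Rightarrow> nat \<Rightarrow> real poly \<times> real poly" where
  "state S 0 = (0, 1)"
| "state S (Suc m) = (let (u, d) = state S m in
     if Suc m \<in> S then (0, dn u) else (anti (u + d), dn d))"

text \<open>By \<open>anti_bern\<close> and \<open>dn_bern\<close>, integrating the weight of a
  permutation yields the sum of the weights of its extensions by an ascent or a descent.\<close>

lemma state_eq_sum:
  "fst (state S m) = (\<Sum>\<sigma> | \<sigma> permutes {1..Suc m}.
      if peak_set (Suc m) \<sigma> = S \<inter> {1..<Suc m} \<and> ends_up m \<sigma> then bern m (\<sigma> (Suc m) - 1) else 0) \<and>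
   snd (state S m) = (\<Sum>\<sigma> | \<sigma> permutes {1..Suc m}.
      if peak_set (Suc m) \<sigma> = S \<inter> {1..<Suc m} \<and> \<not> ends_up m \<sigma> then bern m (\<sigma> (Suc m) - 1) else 0)"
proof (induction m)
  \<comment> \<open>A single entry does not end with an ascent, in accordance with the initial state
    \<open>(0, 1)\<close>.\<close>
  case 0
  have "{\<sigma> :: nat \<Rightarrow> nat. \<sigma> permutes {1..Suc 0}} = {id}"
    by auto
  then show ?case
    by (simp add: ends_up_def peak_set_def bern_def one_pCons)
next
  case (Suc m)
  let ?ok = "\<lambda>\<tau>. peak_set (Suc m) \<tau> = S \<inter> {1..<Suc m}"
  let ?P = "{\<tau>. \<tau> permutes {1..Suc m}}"
  have range: "\<tau> (Suc m) \<in> {1..Suc m}" if "\<tau> permutes {1..Suc m}" for \<tau>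
    using permutes_in_image [OF that, of "Suc m"] by auto
  have anti: "anti (bern m (j - 1)) = (\<Sum>i\<in>{1..Suc (Suc m)}. if j < i then bern (Suc m) (i - 1) else 0)"
    if "j \<in> {1..Suc m}" for j
  proof -
    have "anti (bern m (j - 1)) = (\<Sum>k\<in>{j - 1<..Suc m}. bern (Suc m) k)"
      using that by (intro anti_bern) auto
    also have "\<dots> = (\<Sum>i\<in>{j<..Suc (Suc m)}. bern (Suc m) (i - 1))"
      using that by (intro sum.reindex_bij_witness [of _ "\<lambda>i. i - 1" Suc]) auto
    also have "\<dots> = (\<Sum>i\<in>{1..Suc (Suc m)}. if j < i then bern (Suc m) (i - 1) else 0)"
      using that by (intro sum.mono_neutral_cong_left) auto
    finally show ?thesis .
  qed
  have dn: "dn (bern m (j - 1)) = (\<Sum>i\<in>{1..Suc (Suc m)}. if i \<le> j then bern (Suc m) (i - 1) else 0)"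
    if "j \<in> {1..Suc m}" for j
  proof -
    have "dn (bern m (j - 1)) = (\<Sum>k\<le>j - 1. bern (Suc m) k)"
      using that by (intro dn_bern) auto
    also have "\<dots> = (\<Sum>i\<in>{1..j}. bern (Suc m) (i - 1))"
      using that by (intro sum.reindex_bij_witness [of _ "\<lambda>i. i - 1" Suc]) auto
    also have "\<dots> = (\<Sum>i\<in>{1..Suc (Suc m)}. if i \<le> j then bern (Suc m) (i - 1) else 0)"
      using that by (intro sum.mono_neutral_cong_left) auto
    finally show ?thesis .
  qed
  have sum_if: "(\<Sum>i\<in>A. if b then f i else 0) = (if b then sum f A else 0)"
    for A :: "nat set" and b and f :: "nat \<Rightarrow> real poly"
    by simp
  have last: "insert_last (Suc m) \<tau> i (Suc (Suc m)) = i" for \<tau> i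
    by (simp add: insert_last_def)
  \<comment> \<open>An entry appended above the old last one prevents a peak at
    \<open>Suc m\<close>.\<close>
  have up: "(\<Sum>\<sigma> | \<sigma> permutes {1..Suc (Suc m)}.
      if peak_set (Suc (Suc m)) \<sigma> = S \<inter> {1..<Suc (Suc m)} \<and> ends_up (Suc m) \<sigma>
      then bern (Suc m) (\<sigma> (Suc (Suc m)) - 1) else 0)
    = (\<Sum>\<tau>\<in>?P. if ?ok \<tau> \<and> Suc m \<notin> S then anti (bern m (\<tau> (Suc m) - 1)) else 0)"
    unfolding sum_permutes_Suc [of _ "Suc m"] peak_set_insert_last_eq_iff ends_up_insert_last last
  proof (intro sum.cong refl)
    fix \<tau> assume \<tau>: "\<tau> \<in> ?P"
    let ?C = "?ok \<tau> \<and> Suc m \<notin> S"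
    have "(\<Sum>i = 1..Suc (Suc m).
        if (?ok \<tau> \<and> (Suc m \<in> S \<longleftrightarrow> ends_up m \<tau> \<and> i \<le> \<tau> (Suc m))) \<and> \<tau> (Suc m) < i
        then bern (Suc m) (i - 1) else 0)
      = (\<Sum>i = 1..Suc (Suc m). if ?C then if \<tau> (Suc m) < i then bern (Suc m) (i - 1) else 0 else 0)"
      by (rule sum.cong [OF refl]) auto
    also have "\<dots> = (if ?C then \<Sum>i = 1..Suc (Suc m). if \<tau> (Suc m) < i then bern (Suc m) (i - 1) else 0 else 0)"
      by (rule sum_if)
    also have "(\<Sum>i = 1..Suc (Suc m). if \<tau> (Suc m) < i then bern (Suc m) (i - 1) else 0)
      = anti (bern m (\<tau> (Suc m) - 1))"
      using \<tau> by (intro anti [symmetric] range) simp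
    finally show "(\<Sum>i = 1..Suc (Suc m).
        if (?ok \<tau> \<and> (Suc m \<in> S \<longleftrightarrow> ends_up m \<tau> \<and> i \<le> \<tau> (Suc m))) \<and> \<tau> (Suc m) < i
        then bern (Suc m) (i - 1) else 0)
      = (if ?C then anti (bern m (\<tau> (Suc m) - 1)) else 0)" .
  qed
  \<comment> \<open>An entry appended below makes \<open>Suc m\<close> a peak exactly if the prefix
    ended with an ascent.\<close>
  have down: "(\<Sum>\<sigma> | \<sigma> permutes {1..Suc (Suc m)}.
      if peak_set (Suc (Suc m)) \<sigma> = S \<inter> {1..<Suc (Suc m)} \<and> \<not> ends_up (Suc m) \<sigma>
      then bern (Suc m) (\<sigma> (Suc (Suc m)) - 1) else 0)
    = (\<Sum>\<tau>\<in>?P. if ?ok \<tau> \<and> (Suc m \<in> S \<longleftrightarrow> ends_up m \<tau>) then dn (bern m (\<tau> (Suc m) - 1)) else 0)"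
    unfolding sum_permutes_Suc [of _ "Suc m"] peak_set_insert_last_eq_iff ends_up_insert_last last
  proof (intro sum.cong refl)
    fix \<tau> assume \<tau>: "\<tau> \<in> ?P"
    let ?C = "?ok \<tau> \<and> (Suc m \<in> S \<longleftrightarrow> ends_up m \<tau>)"
    have "(\<Sum>i = 1..Suc (Suc m).
        if (?ok \<tau> \<and> (Suc m \<in> S \<longleftrightarrow> ends_up m \<tau> \<and> i \<le> \<tau> (Suc m))) \<and> \<not> \<tau> (Suc m) < i
        then bern (Suc m) (i - 1) else 0)
      = (\<Sum>i = 1..Suc (Suc m). if ?C then if i \<le> \<tau> (Suc m) then bern (Suc m) (i - 1) else 0 else 0)"
      by (rule sum.cong [OF refl]) auto
    also have "\<dots> = (if ?C then \<Sum>i = 1..Suc (Suc m). if i \<le> \<tau> (Suc m) then bern (Suc m) (i - 1) else 0 else 0)"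
      by (rule sum_if)
    also have "(\<Sum>i = 1..Suc (Suc m). if i \<le> \<tau> (Suc m) then bern (Suc m) (i - 1) else 0)
      = dn (bern m (\<tau> (Suc m) - 1))"
      using \<tau> by (intro dn [symmetric] range) simp
    finally show "(\<Sum>i = 1..Suc (Suc m).
        if (?ok \<tau> \<and> (Suc m \<in> S \<longleftrightarrow> ends_up m \<tau> \<and> i \<le> \<tau> (Suc m))) \<and> \<not> \<tau> (Suc m) < i
        then bern (Suc m) (i - 1) else 0)
      = (if ?C then dn (bern m (\<tau> (Suc m) - 1)) else 0)" .
  qed
  have anti_if: "anti (if b then p else 0) = (if b then anti p else 0)"
    and dn_if: "dn (if b then p else 0) = (if b then dn p else 0)" for b p
    by simp_all
  obtain u d where state: "state S m = (u, d)"
    by fastforce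
  have u: "u = (\<Sum>\<tau>\<in>?P. if ?ok \<tau> \<and> ends_up m \<tau> then bern m (\<tau> (Suc m) - 1) else 0)"
    and d: "d = (\<Sum>\<tau>\<in>?P. if ?ok \<tau> \<and> \<not> ends_up m \<tau> then bern m (\<tau> (Suc m) - 1) else 0)"
    using Suc state by simp_all
  have ud: "u + d = (\<Sum>\<tau>\<in>?P. if ?ok \<tau> then bern m (\<tau> (Suc m) - 1) else 0)"
    unfolding u d sum.distrib [symmetric] by (intro sum.cong) auto
  show ?case
  proof (cases "Suc m \<in> S")
    case True
    have "dn u = (\<Sum>\<tau>\<in>?P. if ?ok \<tau> \<and> ends_up m \<tau> then dn (bern m (\<tau> (Suc m) - 1)) else 0)"
      unfolding u dn_sum dn_if ..
    then show ?thesis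
      unfolding up down using True by (simp add: state)
  next
    case False
    have "anti (u + d) = (\<Sum>\<tau>\<in>?P. if ?ok \<tau> then anti (bern m (\<tau> (Suc m) - 1)) else 0)"
      unfolding ud anti_sum anti_if ..
    moreover have "dn d = (\<Sum>\<tau>\<in>?P. if ?ok \<tau> \<and> \<not> ends_up m \<tau> then dn (bern m (\<tau> (Suc m) - 1)) else 0)"
      unfolding d dn_sum dn_if ..
    ultimately show ?thesis
      unfolding up down using False by (simp add: state)
  qed
qed

text \<open>By \<open>mass_bern\<close> all permutations contribute equally, whatever their last
  value.\<close>

lemma mass_state:
  "mass (fst (state S m) + snd (state S m))
     = card {\<sigma>. \<sigma> permutes {1..Suc m} \<and> peak_set (Suc m) \<sigma> = S \<inter> {1..<Suc m}} / fact (Suc m)"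
proof -
  let ?ok = "\<lambda>\<sigma>. peak_set (Suc m) \<sigma> = S \<inter> {1..<Suc m}"
  let ?P = "{\<sigma>. \<sigma> permutes {1..Suc m}}"
  have fin: "finite ?P"
    by (rule finite_permutations) simp
  have total: "fst (state S m) + snd (state S m) = (\<Sum>\<sigma>\<in>?P. if ?ok \<sigma> then bern m (\<sigma> (Suc m) - 1) else 0)"
    unfolding state_eq_sum [THEN conjunct1] state_eq_sum [THEN conjunct2] sum.distrib [symmetric]
    by (intro sum.cong) auto
  have "mass (fst (state S m) + snd (state S m)) = (\<Sum>\<sigma>\<in>?P. if ?ok \<sigma> then 1 / fact (Suc m) else 0)"
    unfolding total mass_sum
  proof (intro sum.cong refl)
    fix \<sigma> assume "\<sigma> \<in> ?P"
    then have "\<sigma> (Suc m) \<in> {1..Suc m}"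
      using permutes_in_image [of \<sigma> "{1..Suc m}" "Suc m"] by auto
    then show "mass (if ?ok \<sigma> then bern m (\<sigma> (Suc m) - 1) else 0) = (if ?ok \<sigma> then 1 / fact (Suc m) else 0)"
      using mass_bern [of "\<sigma> (Suc m) - 1" m] by (auto simp: mass_def)
  qed
  also have "\<dots> = (\<Sum>\<sigma>\<in>{\<sigma> \<in> ?P. ?ok \<sigma>}. 1 / fact (Suc m))"
    by (rule sum.inter_filter [OF fin, symmetric])
  also have "\<dots> = card {\<sigma> \<in> ?P. ?ok \<sigma>} / fact (Suc m)"
    by (simp only: sum_constant times_divide_eq_right mult_1_right)
  finally show ?thesis
    by (simp only: mem_Collect_eq)
qed

section \<open>Compositions and peak sets\<close>

primrec partial_sums :: "nat \<Rightarrow> nat list \<Rightarrow> nat list" where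
  "partial_sums a [] = []"
| "partial_sums a (g # v) = (a + g) # partial_sums (a + g) v"

primrec differences :: "nat \<Rightarrow> nat list \<Rightarrow> nat list" where
  "differences a [] = []"
| "differences a (y # ys) = (y - a) # differences y ys"

lemma map_diff_eq_differences:
  "map (\<lambda>j. (a # ys) ! j - (a # ys) ! (j - 1)) [1..<length (a # ys)] = differences a ys"
proof (induction ys arbitrary: a)
  case (Cons y ys)
  have "[1..<length (a # y # ys)] = 1 # map Suc [1..<length (y # ys)]"
    by (simp add: upt_conv_Cons map_Suc_upt del: upt_Suc)
  moreover have "map (\<lambda>j. (y # ys) ! j - (a # y # ys) ! j) [1..<length (y # ys)] = differences y ys"
    unfolding Cons.IH [of y, symmetric]
  proof (intro map_cong refl)
    fix j assume "j \<in> set [1..<length (y # ys)]"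
    then show "(y # ys) ! j - (a # y # ys) ! j = (y # ys) ! j - (y # ys) ! (j - 1)"
      unfolding set_upt by (cases j) simp_all
  qed
  ultimately show ?case
    by (simp add: comp_def del: upt_Suc)
qed simp

lemma differences_partial_sums: "differences a (partial_sums a c) = c"
  by (induction c arbitrary: a) auto

text \<open>Sortedness keeps the subtractions in \<open>differences\<close> from truncating.\<close>

lemma partial_sums_differences: "sorted (a # ys) \<Longrightarrow> partial_sums a (differences a ys) = ys"
  by (induction ys arbitrary: a) auto

lemma partial_sums_ge: "x \<in> set (partial_sums a c) \<Longrightarrow> a \<le> x"
  by (induction c arbitrary: a) fastforce+

lemma partial_sums_gt: "x \<in> set (partial_sums a c) \<Longrightarrow> 0 \<notin> set c \<Longrightarrow> a < x"
  by (induction c arbitrary: a) fastforce+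

lemma sorted_partial_sums: "0 \<notin> set c \<Longrightarrow> sorted_wrt (<) (partial_sums a c)"
  by (induction c arbitrary: a) (auto dest: partial_sums_gt)

lemma partial_sums_eq_Nil_iff [simp]: "partial_sums a c = [] \<longleftrightarrow> c = []"
  by (cases c) auto

lemma last_partial_sums: "c \<noteq> [] \<Longrightarrow> last (partial_sums a c) = a + sum_list c"
  by (induction c arbitrary: a) auto

text \<open>The last partial sum is the length of the word, not a peak.\<close>

definition peaks_of :: "nat list \<Rightarrow> nat set" where
  "peaks_of c = set (butlast (partial_sums 0 c))"

lemma partial_sums_split: "c \<noteq> [] \<Longrightarrow> partial_sums 0 c = butlast (partial_sums 0 c) @ [sum_list c]"
  using last_partial_sums [of c 0] by (metis append_butlast_last_id partial_sums_eq_Nil_iff add_0)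

lemma peaks_of_subset:
  assumes "0 \<notin> set c" "c \<noteq> []"
  shows "peaks_of c \<subseteq> {1..<sum_list c}"
proof -
  have "sorted_wrt (<) (butlast (partial_sums 0 c) @ [sum_list c])"
    using sorted_partial_sums [of c 0] assms partial_sums_split by metis
  moreover have "0 < x" if "x \<in> peaks_of c" for x
    using that partial_sums_gt [of x 0 c] assms by (auto simp: peaks_of_def dest: in_set_butlastD)
  ultimately show ?thesis
    by (fastforce simp: peaks_of_def sorted_wrt_append)
qed

lemma peak_composition_eq_iff:
  assumes "0 \<notin> set c" "c \<noteq> []" "n = sum_list c"
  shows "peak_composition n \<sigma> = c \<longleftrightarrow> peak_set n \<sigma> = peaks_of c"
proof -
  let ?L = "sorted_list_of_set (peak_set n \<sigma>)"
  let ?c = "butlast (partial_sums 0 c)"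
  have fin: "finite (peak_set n \<sigma>)"
    by (simp add: peak_set_def)
  have diff: "peak_composition n \<sigma> = differences 0 (?L @ [n])"
    using map_diff_eq_differences [of 0 "?L @ [n]"] by (simp add: peak_composition_def)
  have "sorted (0 # ?L @ [n])"
    using fin by (auto simp: sorted_append peak_set_def)
  then have "peak_composition n \<sigma> = c \<longleftrightarrow> ?L @ [n] = partial_sums 0 c"
    by (metis diff differences_partial_sums partial_sums_differences)
  also have "\<dots> \<longleftrightarrow> ?L = ?c"
    using partial_sums_split [OF assms(2)] assms(3) by (metis append_same_eq)
  also have "\<dots> \<longleftrightarrow> peak_set n \<sigma> = peaks_of c"
  proof
    assume "?L = ?c"
    then show "peak_set n \<sigma> = peaks_of c"
      using fin by (metis peaks_of_def set_sorted_list_of_set)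
  next
    assume eq: "peak_set n \<sigma> = peaks_of c"
    have "sorted_wrt (<) ?c"
      using sorted_partial_sums [OF assms(1), of 0] partial_sums_split [OF assms(2)]
      by (metis sorted_wrt_append)
    then show "?L = ?c"
      unfolding eq peaks_of_def
      by (simp add: strict_sorted_iff sorted_list_of_set.idem_if_sorted_distinct)
  qed
  finally show ?thesis .
qed

section \<open>Reading a composition part by part\<close>

lemma state_add:
  assumes "state S a = (0, d)" "\<forall>i. a < i \<and> i \<le> a + j \<longrightarrow> i \<notin> S"
  shows "state S (a + j) = (ups j d, (dn ^^ j) d)"
  using assms(2) by (induction j) (simp_all add: assms(1))

text \<open>The set \<open>S\<close> is prescribed only strictly between \<open>a\<close> and the
  end, so that the hypothesis passes to the tail, read from the peak \<open>a + g\<close>.\<close>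

lemma mass_state_eq_val:
  assumes "state S a = (0, d)" "0 \<notin> set c" "c \<noteq> []"
    and "\<forall>i. a < i \<and> i < a + sum_list c \<longrightarrow> (i \<in> S \<longleftrightarrow> i \<in> set (butlast (partial_sums a c)))"
  shows "mass (fst (state S (a + sum_list c - 1)) + snd (state S (a + sum_list c - 1))) = val d c"
  using assms
proof (induction c arbitrary: a d)
  case (Cons g v)
  then obtain j where g: "g = Suc j"
    by (cases g) auto
  have state: "state S (a + j) = (ups j d, (dn ^^ j) d)"
  proof (rule state_add [OF Cons.prems(1)], intro allI impI notI)
    fix i assume i: "a < i \<and> i \<le> a + j" "i \<in> S"
    then have "i \<in> set (butlast (partial_sums a (g # v)))"
      using Cons.prems(4) g by auto
    then have "a + g \<le> i"
      using partial_sums_ge [of i "a + g" v] by (auto dest!: in_set_butlastD split: if_splits)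
    then show False
      using i g by simp
  qed
  show ?case
  proof (cases "v = []")
    case True
    then show ?thesis
      using state g by simp
  next
    case False
    have "sum_list v > 0"
      using False Cons.prems(2) by (cases v) auto
    then have "a + g \<in> S"
      using Cons.prems(4) g False by auto
    then have "state S (a + g) = (0, dn (ups j d))"
      using state by (simp add: g)
    moreover have "i \<in> S \<longleftrightarrow> i \<in> set (butlast (partial_sums (a + g) v))"
      if "a + g < i" "i < a + g + sum_list v" for i
      using Cons.prems(4) that False by auto
    ultimately show ?thesis
      using Cons.IH [of "a + g" "dn (ups j d)"] Cons.prems(2) False
      by (simp add: val_Cons g add.assoc)
  qed
qed simp

lemma peak_count_eq_density:
  assumes "is_composition n c" "0 < n"
  shows "real (peak_count n c) = density c * fact n"
proof -
  have c: "0 \<notin> set c" "c \<noteq> []" "n = sum_list c"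
    using assms by (auto simp: is_composition_def)
  obtain m where m: "n = Suc m"
    using assms(2) by (cases n) auto
  have "peaks_of c = peaks_of c \<inter> {1..<n}"
    using peaks_of_subset [OF c(1,2)] c(3) by auto
  then have "peak_count n c = card {\<sigma>. \<sigma> permutes {1..n} \<and> peak_set n \<sigma> = peaks_of c \<inter> {1..<n}}"
    unfolding peak_count_def peak_composition_eq_iff [OF c] by simp
  moreover have "mass (fst (state (peaks_of c) m) + snd (state (peaks_of c) m)) = density c"
  proof -
    have "m = 0 + sum_list c - 1"
      using m c(3) by simp
    then show ?thesis
      using c by (simp only:) (rule mass_state_eq_val, simp_all add: peaks_of_def)
  qed
  ultimately show ?thesis
    using mass_state [of "peaks_of c" m] m by (simp add: field_simps del: fact_Suc)
qed

section \<open>The maximum\<close>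

text \<open>The claimed maximum over \<open>n!\<close>, with \<open>3^(-l)\<close> split off:
  \<open>9 / 5 = 3^2 / 5\<close> and \<open>6 / 5 = 3 * 2 / 5\<close>.\<close>

definition peak_bound :: "nat \<Rightarrow> real" where
  "peak_bound n = [9 / 5, 6 / 5, 1] ! (n mod 3) * (1 / 3) ^ (n div 3)"

lemma peak_bound_mod_3:
  "peak_bound (3 * i) = 9 / 5 * (1 / 3) ^ i"
  "peak_bound (Suc (3 * i)) = 6 / 5 * (1 / 3) ^ i"
  "peak_bound (Suc (Suc (3 * i))) = (1 / 3) ^ i"
proof -
  have "Suc (3 * i) mod 3 = 1" "Suc (3 * i) div 3 = i"
    "Suc (Suc (3 * i)) mod 3 = 2" "Suc (Suc (3 * i)) div 3 = i"
    by presburger+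
  then show "peak_bound (3 * i) = 9 / 5 * (1 / 3) ^ i"
    "peak_bound (Suc (3 * i)) = 6 / 5 * (1 / 3) ^ i"
    "peak_bound (Suc (Suc (3 * i))) = (1 / 3) ^ i"
    by (simp_all add: peak_bound_def)
qed

lemma mod_3_cases:
  fixes n :: nat
  obtains i where "n = 3 * i" | i where "n = Suc (3 * i)" | i where "n = Suc (Suc (3 * i))"
proof -
  have "n = 3 * (n div 3) \<or> n = Suc (3 * (n div 3)) \<or> n = Suc (Suc (3 * (n div 3)))"
    by presburger
  then show ?thesis
    using that by blast
qed

lemma peak_bound_pos: "0 < peak_bound n"
  by (cases n rule: mod_3_cases) (simp_all add: peak_bound_mod_3)

lemma peak_bound_add_3: "peak_bound (Suc (Suc (Suc n))) = peak_bound n / 3"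
proof -
  have "Suc (Suc (Suc (3 * i))) = 3 * Suc i" for i
    by simp
  then show ?thesis
    by (cases n rule: mod_3_cases) (simp_all only: peak_bound_mod_3, simp_all)
qed

text \<open>The ratios of consecutive values are 2/3, 5/6 and 3/5 in turn.\<close>

lemma peak_bound_Suc: "3 / 5 * peak_bound n \<le> peak_bound (Suc n)" "peak_bound (Suc n) \<le> peak_bound n"
proof -
  have *: "Suc (Suc (Suc (3 * i))) = 3 * Suc i" for i
    by simp
  show "3 / 5 * peak_bound n \<le> peak_bound (Suc n)" "peak_bound (Suc n) \<le> peak_bound n"
    by (cases n rule: mod_3_cases; simp only: * peak_bound_mod_3; simp)+
qed

lemma peak_bound_mult:
  assumes "2 \<le> a" "2 \<le> b"
  shows "peak_bound a * peak_bound b \<le> peak_bound (a + b - 2)"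
proof -
  have pow: "(1 / 3 :: real) ^ i * (1 / 3) ^ j = (1 / 3) ^ (i + j)" for i j
    by (simp add: power_add)
  \<comment> \<open>By symmetry six of the nine pairs of residues suffice.\<close>
  have sym: "peak_bound a * peak_bound b \<le> peak_bound (a + b - 2)"
    if ab: "2 \<le> a" "2 \<le> b" "a mod 3 \<le> b mod 3" for a b
  proof -
    obtain i r where a: "a = 3 * i + r" "r < 3" "a mod 3 = r"
      by (metis mod_less_divisor mult_div_mod_eq zero_less_numeral)
    obtain j s where b: "b = 3 * j + s" "s < 3" "b mod 3 = s"
      by (metis mod_less_divisor mult_div_mod_eq zero_less_numeral)
    have "r = 0 \<or> r = 1 \<or> r = 2" "s = 0 \<or> s = 1 \<or> s = 2" "r \<le> s"
      using ab a b by auto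
    then consider "r = 0" "s = 0" | "r = 0" "s = 1" | "r = 0" "s = 2" | "r = 1" "s = 1"
      | "r = 1" "s = 2" | "r = 2" "s = 2"
      by fastforce
    then show ?thesis
    proof cases
      \<comment> \<open>If the residues sum to less than 2, subtracting 2 borrows from
        \<open>i + j\<close>. The claims become 27/25 <= 6/5 here and 18/25 <= 1 in the next
        case.\<close>
      case 1
      then obtain k where k: "i + j = Suc k" "a + b - 2 = Suc (3 * k)"
        using ab a b by (cases "i + j") auto
      have "peak_bound a * peak_bound b = 81 / 25 * ((1 / 3) ^ i * (1 / 3) ^ j)"
        using 1 a b by (simp add: peak_bound_mod_3)
      then show ?thesis
        by (simp only: pow k peak_bound_mod_3) simp
    next
      case 2
      then obtain k where k: "i + j = Suc k" "a + b - 2 = Suc (Suc (3 * k))"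
        using ab a b by (cases "i + j") auto
      have "peak_bound a * peak_bound b = 54 / 25 * ((1 / 3) ^ i * (1 / 3) ^ j)"
        using 2 a b by (simp add: peak_bound_mod_3)
      then show ?thesis
        by (simp only: pow k peak_bound_mod_3) simp
    next
      case 3
      then have "a + b - 2 = 3 * (i + j)" using a b by simp
      with 3 a b show ?thesis
        by (simp only: peak_bound_mod_3) (simp add: peak_bound_mod_3 pow)
    next
      case 4
      then have "a + b - 2 = 3 * (i + j)" using a b by simp
      with 4 a b show ?thesis
        by (simp only: peak_bound_mod_3) (simp add: peak_bound_mod_3 pow)
    next
      case 5
      then have "a + b - 2 = Suc (3 * (i + j))" using a b by simp
      with 5 a b show ?thesis
        by (simp only: peak_bound_mod_3) (simp add: peak_bound_mod_3 pow)
    next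
      case 6
      then have "a + b - 2 = Suc (Suc (3 * (i + j)))" using a b by simp
      with 6 a b show ?thesis
        by (simp only: peak_bound_mod_3) (simp add: peak_bound_mod_3 pow)
    qed
  qed
  show ?thesis
    using sym [of a b] sym [of b a] assms by (cases "a mod 3 \<le> b mod 3") (auto simp: ac_simps)
qed

section \<open>Compositions with one part, and those whose inner parts are all 2\<close>

lemma density_single_le:
  assumes "4 \<le> b"
  shows "density [b] \<le> peak_bound b"
  using assms
proof (induction b rule: nat_induct_at_least)
  \<comment> \<open>The induction cannot start at 3, where the density 2/3 exceeds the bound
    3/5.\<close>
  case base
  show ?case
    by (simp add: val_single fact_numeral peak_bound_def del: val.simps)
next
  case (Suc b)
  have "density [Suc b] = 2 / real (Suc b) * density [b]"
    using Suc.hyps by (cases b) (simp_all add: val_single field_simps del: val.simps of_nat_Suc)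
  also have "\<dots> \<le> 3 / 5 * density [b]"
    using Suc.hyps by (intro mult_right_mono density_nonneg) (simp_all add: field_simps)
  also have "\<dots> \<le> 3 / 5 * peak_bound b"
    using Suc.IH by simp
  also have "\<dots> \<le> peak_bound (Suc b)"
    by (rule peak_bound_Suc)
  finally show ?case .
qed

text \<open>The factors 2/3 and 4/9 account for enlarging one or both end parts. Raising
  \<open>k\<close> by 3 divides the bounds by 9, while \<open>alt\<close> shrinks at least by 5/24 *
  1/2 = 5/48 < 1/9.\<close>

lemma alt_le:
  "alt (Suc k) \<le> peak_bound (2 * k + 7) \<and> 2 / 3 * alt (Suc k) \<le> peak_bound (2 * k + 8)
    \<and> 4 / 9 * alt (Suc k) \<le> peak_bound (2 * k + 9)"
proof (induction k rule: less_induct)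
  case (less k)
  have alt_2: "alt 2 \<le> 1 / 15"
    using alt_Suc [of 1] alt_1 by (simp add: numeral_2_eq_2)
  have alt_3: "alt 3 \<le> 1 / 36"
    using alt_Suc_Suc [of 1] alt_1 by (simp add: numeral_3_eq_3)
  consider "k = 0" | "k = 1" | "k = 2" | j where "k = j + 3"
    by (metis One_nat_def add.commute less_2_cases le_add_diff_inverse less_Suc_eq not_less numeral_2_eq_2 numeral_3_eq_3)
  then show ?case
  proof cases
    case 1
    then show ?thesis using alt_1 by (simp add: peak_bound_def power_numeral_reduce)
  next
    case 2
    then show ?thesis using alt_2 by (simp add: peak_bound_def power_numeral_reduce flip: numeral_2_eq_2)
  next
    case 3
    then show ?thesis using alt_3 by (simp add: peak_bound_def power_numeral_reduce flip: numeral_3_eq_3)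
  next
    case 4
    have "alt (Suc k) \<le> 5 / 24 * alt (Suc (Suc j))"
      using alt_Suc_Suc [of "Suc (Suc j)"] 4 by (simp add: eval_nat_numeral)
    also have "\<dots> \<le> 5 / 24 * (1 / 2 * alt (Suc j))"
      using alt_Suc by (intro mult_left_mono) auto
    also have "\<dots> \<le> 1 / 9 * alt (Suc j)"
      using density_nonneg [of "2 # replicate (Suc j) 2 @ [1]", folded alt_def] by linarith
    finally have alt: "alt (Suc k) \<le> 1 / 9 * alt (Suc j)" .
    have pb: "peak_bound (Suc (Suc (Suc (Suc (Suc (Suc m)))))) = peak_bound m / 9" for m
      by (simp add: peak_bound_add_3)
    have "2 * k + 7 = Suc (Suc (Suc (Suc (Suc (Suc (2 * j + 7))))))"
      "2 * k + 8 = Suc (Suc (Suc (Suc (Suc (Suc (2 * j + 8))))))"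
      "2 * k + 9 = Suc (Suc (Suc (Suc (Suc (Suc (2 * j + 9))))))"
      using 4 by simp_all
    then have "peak_bound (2 * k + 7) = peak_bound (2 * j + 7) / 9"
      "peak_bound (2 * k + 8) = peak_bound (2 * j + 8) / 9"
      "peak_bound (2 * k + 9) = peak_bound (2 * j + 9) / 9"
      by (simp_all only: pb)
    then show ?thesis
      using less [of j] alt 4 by simp
  qed
qed

lemma density_core_le:
  assumes "a = 3 \<or> a = 4" "b = 2 \<or> b = 3"
  shows "density (a # replicate k 2 @ [b]) \<le> peak_bound (a + 2 * k + b)"
proof -
  have alt: "alt k = density (3 # replicate k 2 @ [2])"
    using density_append_2 [of "2 # replicate k 2"]
    by (simp add: alt_def density_2_Cons del: val.simps)
  have s3: "density [3] = 2 / 3"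
    by (simp add: val_single fact_numeral del: val.simps)
  \<comment> \<open>Both factors 2/3 here and in the next claim are \<open>density [3]\<close>, from
    cutting off a last part 3 or shortening a first part 4.\<close>
  have right: "density (a # replicate k 2 @ [3]) \<le> 2 / 3 * density (a # replicate k 2 @ [2])" for a
    using density_split_le [of "a # replicate k 2" 3 "[]"] s3 by (simp add: mult.commute del: val.simps)
  have left: "density (4 # replicate k 2 @ [b]) \<le> 2 / 3 * density (3 # replicate k 2 @ [b])" for b
    using density_Cons_le [of 4 "replicate k 2 @ [b]"] s3 by (simp del: val.simps)
  show ?thesis
  proof (cases k)
    \<comment> \<open>The factor 2/3 is too weak for length 6: it gives 2/9 instead of 1/5, hence
      the exact values.\<close>
    case 0
    have "peak_bound 5 = 1 / 3" "peak_bound 6 = 1 / 5" "peak_bound 7 = 2 / 15"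
      by (simp_all add: peak_bound_def power_numeral_reduce)
    moreover have "density [3, 2] = 1 / 3"
      using alt alt_0 0 by simp
    moreover have "density [4, 3] \<le> 2 / 15"
      using right [of 4] 0 density_4_2 by simp
    ultimately show ?thesis
      using assms 0 density_3_3 density_4_2 by (auto simp del: val.simps)
  next
    case (Suc j)
    have "density (4 # replicate k 2 @ [3]) \<le> 2 / 3 * (2 / 3 * density (3 # replicate k 2 @ [2]))"
      using left [of 3] right [of 3] by linarith
    moreover have "3 + 2 * k + 2 = 2 * j + 7" "4 + 2 * k + 2 = 2 * j + 8"
      "3 + 2 * k + 3 = 2 * j + 8" "4 + 2 * k + 3 = 2 * j + 9"
      using Suc by simp_all
    ultimately show ?thesis
      using assms alt_le [of j] left [of 2] right [of 3] unfolding Suc [symmetric] alt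
      by (elim disjE) (simp_all only:, linarith+)
  qed
qed

section \<open>The upper bound, by induction on the length\<close>

theorem density_le_peak_bound:
  "\<forall>x\<in>set c. 0 < x \<Longrightarrow> 4 \<le> sum_list c \<Longrightarrow> density c \<le> peak_bound (sum_list c)"
proof (induction "sum_list c" arbitrary: c rule: less_induct)
  case less
  note IH = less.hyps and pos = less.prems(1) and n = less.prems(2)
  have part_1: ?case if "c = u @ 1 # v" "v \<noteq> []" for u v
    unfolding that(1) density_part_1 [OF that(2)] by (simp add: peak_bound_pos less_imp_le)
  \<comment> \<open>Both pieces must have sum at least 4 for the induction hypothesis. The left one,
    \<open>u @ [2]\<close>, fails this only for \<open>u = [1]\<close>, where the density is
    0.\<close>
  have cut: ?case if c: "c = u @ g # v" "u \<noteq> []" "3 \<le> g" "4 \<le> sum_list (g # v)" for u g v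
  proof (cases "2 \<le> sum_list u")
    case True
    have "density c \<le> density (u @ [2]) * density (g # v)"
      unfolding c(1) using c by (intro density_split_le) auto
    also have "\<dots> \<le> peak_bound (sum_list (u @ [2])) * peak_bound (sum_list (g # v))"
      using True c pos by (intro mult_mono IH density_nonneg less_imp_le [OF peak_bound_pos]) auto
    also have "\<dots> \<le> peak_bound (sum_list (u @ [2]) + sum_list (g # v) - 2)"
      using c by (intro peak_bound_mult) auto
    also have "sum_list (u @ [2]) + sum_list (g # v) - 2 = sum_list c"
      using c by simp
    finally show ?thesis .
  next
    case False
    then have "u = [1]"
      using c(1,2) pos by (cases u; cases "tl u") auto
    then show ?thesis
      using part_1 [of "[]" "g # v"] c by simp
  qed
  show ?case
  proof (cases "length c < 2")
    case True
    then obtain h where "c = [h]"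
      using n by (cases c) auto
    then show ?thesis
      using density_single_le [of h] n by (simp del: val.simps)
  next
    case False
    then obtain a w b where c: "c = a # w @ [b]"
      by (metis One_nat_def append_butlast_last_id append_Cons append_Nil length_append_singleton less_Suc_eq list.exhaust list.size(3) numeral_2_eq_2 zero_less_Suc)
    consider "4 \<le> b" | "5 \<le> a" | "\<exists>g\<in>set w. 3 \<le> g" | "1 \<in> set (a # w)"
      | "b \<le> 3" "a \<le> 4" "\<forall>g\<in>set w. g \<le> 2" "1 \<notin> set (a # w)"
      by force
    then show ?thesis
    proof cases
      case 1
      then show ?thesis
        using c by (intro cut [of "a # w" b "[]"]) auto
    next
      case 2
      \<comment> \<open>As \<open>a\<close> is at least 5, \<open>density_single_le\<close> applies
        to \<open>a - 1\<close>.\<close>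
      have "density c \<le> density [a - 1] * density (3 # w @ [b])"
        unfolding c using 2 by (intro density_Cons_le) auto
      also have "\<dots> \<le> peak_bound (a - 1) * peak_bound (sum_list (3 # w @ [b]))"
        using 2 c pos by (intro mult_mono density_single_le IH density_nonneg less_imp_le [OF peak_bound_pos]) auto
      also have "\<dots> \<le> peak_bound (a - 1 + sum_list (3 # w @ [b]) - 2)"
        using 2 by (intro peak_bound_mult) auto
      also have "a - 1 + sum_list (3 # w @ [b]) - 2 = sum_list c"
        using c 2 by simp
      finally show ?thesis .
    next
      case 3
      then obtain g w1 w2 where "w = w1 @ g # w2" "3 \<le> g"
        by (metis split_list)
      then show ?thesis
        using c pos by (intro cut [of "a # w1" g "w2 @ [b]"]) auto
    next
      case 4
      then obtain u v where "a # w = u @ 1 # v"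
        by (metis split_list)
      then show ?thesis
        using c by (intro part_1 [of u "v @ [b]"]) simp_all
    next
      case 5
      have "a \<noteq> 1" "0 < a" "0 < b"
        using 5 pos c by auto
      then have ab: "a = 2 \<or> a = 3 \<or> a = 4" "b = 1 \<or> b = 2 \<or> b = 3"
        using 5(1,2) by linarith+
      have "x = 2" if "x \<in> set w" for x
      proof -
        have "0 < x" "x \<le> 2" "x \<noteq> 1"
          using that 5(3,4) pos c by auto
        then show ?thesis
          by linarith
      qed
      then obtain k where k: "w = replicate k 2"
        by (metis replicate_eqI)
      \<comment> \<open>A first part 2 may become 3 and a last part 1 may become 2 at equal density.
        The sum grows, but \<open>peak_bound\<close> is decreasing.\<close>
      define a' where "a' = (if a = 2 then 3 else a)"
      define b' where "b' = (if b = 1 then 2 else b)"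
      have "density c = density (a # w @ [b'])"
        using density_append_2 [of "a # w"] by (auto simp: c b'_def simp del: val.simps)
      also have "\<dots> = density (a' # w @ [b'])"
        by (simp add: a'_def density_2_Cons del: val.simps)
      also have "\<dots> \<le> peak_bound (a' + 2 * k + b')"
        unfolding k using ab by (intro density_core_le) (auto simp: a'_def b'_def)
      also have "\<dots> \<le> peak_bound (a + 2 * k + b)"
        by (rule lift_Suc_antimono_le [of peak_bound, OF peak_bound_Suc(2)]) (auto simp: a'_def b'_def)
      also have "a + 2 * k + b = sum_list c"
        by (simp add: c k sum_list_replicate)
      finally show ?thesis .
    qed
  qed
qed

section \<open>Compositions that attain the bound\<close>

lemma density_replicate_3:
  assumes "v \<noteq> []"
  shows "density (replicate j 3 @ 3 # v) = (1 / 3) ^ j * density (3 # v)"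
proof (induction j)
  case (Suc j)
  have "density [3, 2] = 1 / 3"
    using density_append_2 [of "[2]"] density_2_Cons [of "[2]"] mass_dn_anti_1 by simp
  \<comment> \<open>Cutting at the second 3 splits off the factor
    \<open>density [3, 2]\<close>.\<close>
  moreover have "density (3 # replicate j 3 @ 3 # v) = density [3, 2] * density (replicate j 3 @ 3 # v)"
    using density_split_3 [of "replicate j 3 @ v" "[3]"] assms density_split_3 [of v "replicate j 3"]
    by (simp add: replicate_app_Cons_same del: val.simps)
  ultimately show ?case
    using Suc by (simp del: val.simps)
qed simp

lemma peak_bound_attained:
  assumes "6 \<le> n"
  obtains c where "is_composition n c" "density c = peak_bound n"
proof -
  have "density [3, 2] = 1 / 3" "density [3, 2, 2] = 2 / 15"
    using alt_0 alt_1 density_append_2 [of "[2]"] density_append_2 [of "[2, 2]"]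
      density_2_Cons [of "[2]"] density_2_Cons [of "[2, 2]"]
    by (simp_all add: alt_def del: val.simps)
  \<comment> \<open>At \<open>j = 0\<close> the three families have lengths 5, 6 and 7, so every
    \<open>n\<close> from 6 on is reached.\<close>
  then have *: "density (replicate j 3 @ [3, 2]) = peak_bound (Suc (Suc (3 * Suc j)))"
    "density (replicate j 3 @ [3, 3]) = peak_bound (3 * Suc (Suc j))"
    "density (replicate j 3 @ [3, 2, 2]) = peak_bound (Suc (3 * Suc (Suc j)))" for j
    unfolding peak_bound_mod_3
    using density_replicate_3 [of "[2]" j] density_replicate_3 [of "[3]" j]
      density_replicate_3 [of "[2, 2]" j] density_3_3
    by (simp_all del: val.simps)
  have comp: "is_composition (Suc (Suc (3 * Suc j))) (replicate j 3 @ [3, 2])"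
    "is_composition (3 * Suc (Suc j)) (replicate j 3 @ [3, 3])"
    "is_composition (Suc (3 * Suc (Suc j))) (replicate j 3 @ [3, 2, 2])" for j
    by (auto simp: is_composition_def sum_list_replicate)
  show ?thesis
  proof (cases n rule: mod_3_cases)
    case (1 i)
    with assms have "2 \<le> i"
      by simp
    then obtain j where "i = Suc (Suc j)"
      by (auto simp: le_iff_add)
    with 1 that *(2) comp(2) show ?thesis
      by blast
  next
    case (2 i)
    with assms have "2 \<le> i"
      by simp
    then obtain j where "i = Suc (Suc j)"
      by (auto simp: le_iff_add)
    with 2 that *(3) comp(3) show ?thesis
      by blast
  next
    case (3 i)
    with assms obtain j where "i = Suc j"
      by (cases i) auto
    with 3 that *(1) comp(1) show ?thesis
      by blast
  qed
qed

theorem theorem1p2: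
  fixes n l :: nat and c :: "nat list"
  assumes "n \<ge> 6"
    and "maximal_composition n c"
    and "l = n div 3"
  shows "(n mod 3 = 0 \<longrightarrow> real (peak_count n c) = 1 / 5 * 3 powi (2 - int l) * fact n)
       \<and> (n mod 3 = 1 \<longrightarrow> real (peak_count n c) = 2 / 5 * 3 powi (1 - int l) * fact n)
       \<and> (n mod 3 = 2 \<longrightarrow> real (peak_count n c) = 3 powi (- int l) * fact n)"
proof -
  have c: "is_composition n c" and max: "\<And>b. is_composition n b \<Longrightarrow> peak_count n b \<le> peak_count n c"
    using assms(2) by (auto simp: maximal_composition_def)
  have n: "0 < n"
    using assms(1) by simp
  obtain b where b: "is_composition n b" "density b = peak_bound n"
    using peak_bound_attained [OF assms(1)] .
  \<comment> \<open>Maximality of \<open>c\<close> against the attaining \<open>b\<close> gives the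
    lower bound.\<close>
  have "real (peak_count n b) \<le> real (peak_count n c)"
    using max [OF b(1)] by simp
  then have "peak_bound n * fact n \<le> real (peak_count n c)"
    using peak_count_eq_density [OF b(1) n] b(2) by simp
  moreover have "real (peak_count n c) \<le> peak_bound n * fact n"
    using peak_count_eq_density [OF c n] density_le_peak_bound [of c] c assms(1)
    by (simp add: is_composition_def del: val.simps)
  ultimately have "real (peak_count n c) = peak_bound n * fact n"
    by simp
  then show ?thesis
    by (intro conjI impI)
      (simp_all add: peak_bound_def assms(3) power_int_diff power_int_minus power_one_over field_simps)
qed

end
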